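(* Let a diagram carry a semi-proper labeling, and let $r_0,r_1,\ldots,r_m$ be labels in columns $c_0<c_1<\cdots<c_m$ forming an $r_0$-exchange sequence. Then the composite of exchange labelings $\mathcal{L}^{c_0}_{r_0,r_1}\cdots\mathcal{L}^{c_{m-1}}_{r_{m-1},r_m}$ (applying $\mathcal{L}^{c_{m-1}}_{r_{m-1},r_m}$ first and $\mathcal{L}^{c_0}_{r_0,r_1}$ last) is a semi-proper labeling, and in it the cell that carried label $r_i$ in column $c_i$ is re-labeled to $r_0$.
   Context: A diagram is a finite set of cells $(c,r)\in\mathbb{Z}_{>0}^2$ (column $c$, row $r$, rows numbered upward). A labeling assigns positive integers to cells; it is semi-proper of shape $\alpha\in\mathbb{Z}_{\ge0}^m$ if (i) for each column $c$ the entries in column $c$ are distinct and form exactly $\{r:\alpha_r\ge c\}$; (ii) every entry in row $r$ is at least $r$; (iii) cells with a given entry weakly descend from left to right. For labels $r<s$, $s$ touches $r$ at column $c$ if there is an $s$ in column $c+1$ lying weakly below the $r$ in column $c$; then $s$ crosses $r$ if there is an $r$ in column $c+1$ above that $s$, and otherwise $s$ abuts $r$. (The same terminology is used for any two labels, the larger one touching/abutting the smaller.) If $s$ abuts $r$ in column $c$ in a semi-proper labeling of shape $\alpha$, the exchange labeling $\mathcal{L}^{c}_{r,s}$ simultaneously changes every $r$ to $s$ and every $s$ to $r$ in columns $c+1,\ldots,d$, where $d$ is the leftmost column right of $c$ at which $s$ touches $r$ if it exists, and otherwise $d=\alpha_s$. A sequence of labels $r_0,r_1,\ldots,r_m$ in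 columns $c_0<c_1<\cdots<c_m$ is an $r_0$-exchange sequence if each $r_i$ abuts $r_{i-1}$ in column $c_{i-1}$, and for $i<j$, $r_j$ does not touch $r_i$ in any column $c$ with $c_i<c\le c_j$. *)

theory Defs
  imports Main "HOL-Combinatorics.Transposition"
begin

text \<open>Cells are pairs (column, row); rows are numbered upward, so ``below'' means smaller row.\<close>

type_synonym cell = "nat \<times> nat"

text \<open>Only the values of a labeling on the cells of the diagram are relevant.\<close>

type_synonym labeling = "cell \<Rightarrow> nat"

definition diagram :: "cell set \<Rightarrow> bool" where
  "diagram D \<longleftrightarrow> finite D \<and> (\<forall>(c, b) \<in> D. 1 \<le> c \<and> 1 \<le> b)"

definition occurs_at :: "cell set \<Rightarrow> labeling \<Rightarrow> nat \<Rightarrow> nat \<Rightarrow> nat \<Rightarrow> bool" where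
  "occurs_at D L r c b \<longleftrightarrow> (c, b) \<in> D \<and> L (c, b) = r"

text \<open>A weak composition \<open>(\<alpha>\<^sub>1, \<dots>, \<alpha>\<^sub>n)\<close> is a function of which only the values on
  \<open>{1..n}\<close> are used. Labels on \<open>D\<close> are positive by the second conjunct.\<close>

definition semi_proper_of_shape :: "nat \<Rightarrow> (nat \<Rightarrow> nat) \<Rightarrow> cell set \<Rightarrow> labeling \<Rightarrow> bool" where
  "semi_proper_of_shape n \<alpha> D L \<longleftrightarrow>
     (\<forall>c \<ge> 1. inj_on L {x \<in> D. fst x = c}) \<and>
     (\<forall>c \<ge> 1. L ` {x \<in> D. fst x = c} = {r \<in> {1..n}. c \<le> \<alpha> r}) \<and>
     (\<forall>x \<in> D. snd x \<le> L x) \<and>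
     (\<forall>x \<in> D. \<forall>y \<in> D. L x = L y \<and> fst x < fst y \<longrightarrow> snd y \<le> snd x)"

definition semi_proper :: "nat \<Rightarrow> cell set \<Rightarrow> labeling \<Rightarrow> bool" where
  "semi_proper n D L \<longleftrightarrow> (\<exists>\<alpha>. semi_proper_of_shape n \<alpha> D L)"

text \<open>In the next three definitions \<open>s\<close> touches, crosses or abuts \<open>r\<close> at column \<open>c\<close>;
  the touching label is always the larger one.\<close>

definition touches :: "cell set \<Rightarrow> labeling \<Rightarrow> nat \<Rightarrow> nat \<Rightarrow> nat \<Rightarrow> bool" where
  "touches D L c r s \<longleftrightarrow> r < s \<and>
     (\<exists>a b. occurs_at D L r c a \<and> occurs_at D L s (c + 1) b \<and> b \<le> a)"

definition crosses :: "cell set \<Rightarrow> labeling \<Rightarrow> nat \<Rightarrow> nat \<Rightarrow> nat \<Rightarrow> bool" where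
  "crosses D L c r s \<longleftrightarrow> r < s \<and>
     (\<exists>a b. occurs_at D L r c a \<and> occurs_at D L s (c + 1) b \<and> b \<le> a \<and>
        (\<exists>a'. occurs_at D L r (c + 1) a' \<and> b < a'))"

definition abuts :: "cell set \<Rightarrow> labeling \<Rightarrow> nat \<Rightarrow> nat \<Rightarrow> nat \<Rightarrow> bool" where
  "abuts D L c r s \<longleftrightarrow> touches D L c r s \<and> \<not> crosses D L c r s"

text \<open>The part \<open>\<alpha>\<^sub>s\<close> of the shape, read off from the labeling itself: an exchange may
  change the shape, so in a composite each exchange must use the shape of the labeling
  to which it is applied.\<close>

definition shape_part :: "cell set \<Rightarrow> labeling \<Rightarrow> nat \<Rightarrow> nat" where
  "shape_part D L s = card {x \<in> D. L x = s}"

lemma shape_part_eq: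
  assumes D: "diagram D" and L: "semi_proper_of_shape n \<alpha> D L" and s: "s \<in> {1..n}"
  shows "shape_part D L s = \<alpha> s"
proof -
  have pos: "1 \<le> fst x" if "x \<in> D" for x
    using D that by (auto simp: diagram_def)
  have col: "L ` {x \<in> D. fst x = c} = {r \<in> {1..n}. c \<le> \<alpha> r}" if "c \<ge> 1" for c
    using L that by (simp add: semi_proper_of_shape_def)
  have inj: "inj_on L {x \<in> D. fst x = c}" if "c \<ge> 1" for c
    using L that by (simp add: semi_proper_of_shape_def)
  have "inj_on fst {x \<in> D. L x = s}"
  proof (rule inj_onI)
    fix x y assume xy: "x \<in> {x \<in> D. L x = s}" "y \<in> {x \<in> D. L x = s}" "fst x = fst y"
    show "x = y"
      using inj_onD[OF inj[of "fst x"], of x y] pos[of x] xy by auto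
  qed
  moreover have "fst ` {x \<in> D. L x = s} = {1..\<alpha> s}"
  proof (intro equalityI subsetI)
    fix c assume "c \<in> fst ` {x \<in> D. L x = s}"
    then obtain x where x: "x \<in> D" "L x = s" "fst x = c" by auto
    then have "s \<in> L ` {x \<in> D. fst x = c}" by auto
    then show "c \<in> {1..\<alpha> s}" using col[of c] pos[OF x(1)] x(3) by auto
  next
    fix c assume c: "c \<in> {1..\<alpha> s}"
    then have "s \<in> L ` {x \<in> D. fst x = c}" using col[of c] s by auto
    then show "c \<in> fst ` {x \<in> D. L x = s}" by auto
  qed
  ultimately show ?thesis
    unfolding shape_part_def by (metis card_image card_atLeastAtMost diff_Suc_1)
qed

definition exchange_end :: "cell set \<Rightarrow> labeling \<Rightarrow> nat \<Rightarrow> nat \<Rightarrow> nat \<Rightarrow> nat" where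
  "exchange_end D L c r s =
     (if \<exists>d > c. touches D L d r s then LEAST d. c < d \<and> touches D L d r s
      else shape_part D L s)"

text \<open>The exchange labeling \<open>\<L>\<^sup>c\<close> for \<open>r, s\<close>; it is \<open>None\<close> unless \<open>L\<close> is semi-proper and
  \<open>s\<close> abuts \<open>r\<close> at column \<open>c\<close>.\<close>

definition exchange :: "nat \<Rightarrow> cell set \<Rightarrow> nat \<Rightarrow> nat \<Rightarrow> nat \<Rightarrow> labeling \<Rightarrow> labeling option" where
  "exchange n D c r s L =
     (if semi_proper n D L \<and> abuts D L c r s
      then Some (\<lambda>x. if fst x \<in> {c + 1..exchange_end D L c r s}
                     then transpose r s (L x) else L x)
      else None)"

text \<open>The exchange with the largest index acts first, the one for \<open>r 0, r 1\<close> last.\<close>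

primrec exchange_composite ::
  "nat \<Rightarrow> cell set \<Rightarrow> (nat \<Rightarrow> nat) \<Rightarrow> (nat \<Rightarrow> nat) \<Rightarrow> nat \<Rightarrow> labeling \<Rightarrow> labeling option" where
  "exchange_composite n D r c 0 L = Some L"
| "exchange_composite n D r c (Suc m) L =
     Option.bind (exchange n D (c m) (r m) (r (Suc m)) L) (exchange_composite n D r c m)"

definition exchange_sequence ::
  "cell set \<Rightarrow> labeling \<Rightarrow> nat \<Rightarrow> (nat \<Rightarrow> nat) \<Rightarrow> (nat \<Rightarrow> nat) \<Rightarrow> bool" where
  "exchange_sequence D L m r c \<longleftrightarrow>
     (\<forall>i \<le> m. \<exists>b. occurs_at D L (r i) (c i) b) \<and>
     (\<forall>i < m. c i < c (i + 1)) \<and>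
     (\<forall>i \<in> {1..m}. abuts D L (c (i - 1)) (r (i - 1)) (r i)) \<and>
     (\<forall>j \<le> m. \<forall>i < j. \<forall>k. c i < k \<and> k \<le> c j \<longrightarrow> \<not> touches D L k (r i) (r j))"

end

theory Submission imports Defs begin

text \<open>Write \<open>p r k\<close> for the row of the label \<open>r\<close> in column \<open>k\<close>. Strictly between the abutment at
  \<open>c\<close> and the end \<open>d\<close> of the exchange the label \<open>s\<close> never touches \<open>r\<close>, so \<open>p r k < p s k\<close> for
  \<open>c < k \<le> d\<close>; this makes both spliced label paths descend. For the composite, induct on the length:
  the first exchange (the one for \<open>r m\<close>, \<open>r (m + 1)\<close>) only moves labels to the right of column \<open>c m\<close>,
  and up to column \<open>c (m + 1)\<close> the label \<open>r m\<close> takes over the path of \<open>r (m + 1)\<close>. Hence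
  \<open>r 0, \<dots>, r m\<close> is again an exchange sequence, and its last column may be chosen anywhere between
  \<open>c m\<close> and \<open>c (m + 1)\<close>, which is immaterial for the composite.\<close>

section \<open>Semi-properness of an exchange\<close>

locale semi_proper_labeling =
  fixes n :: nat and \<alpha> :: "nat \<Rightarrow> nat" and D :: "cell set" and L :: labeling
  assumes diagram: "diagram D"
    and semi_proper_of_shape: "semi_proper_of_shape n \<alpha> D L"
begin

section \<open>Rows and columns of a label in a semi-proper labeling\<close>

lemma occurs_at_column_pos: "occurs_at D L t k b \<Longrightarrow> 1 \<le> k"
  using diagram by (auto simp: diagram_def occurs_at_def)

lemma column_inj: "1 \<le> k \<Longrightarrow> inj_on L {x \<in> D. fst x = k}"
  and column_image: "1 \<le> k \<Longrightarrow> L ` {x \<in> D. fst x = k} = {t \<in> {1..n}. k \<le> \<alpha> t}"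
  using semi_proper_of_shape by (simp_all add: semi_proper_of_shape_def)

lemma occurs_at_unique:
  assumes "occurs_at D L t k a" "occurs_at D L t k b"
  shows "a = b"
  using inj_onD[OF column_inj[OF occurs_at_column_pos[OF assms(1)]], of "(k, a)" "(k, b)"] assms
  by (auto simp: occurs_at_def)

lemma ex_occurs_at_iff:
  assumes "1 \<le> k"
  shows "(\<exists>b. occurs_at D L t k b) \<longleftrightarrow> t \<in> {1..n} \<and> k \<le> \<alpha> t"
proof -
  have "(\<exists>b. occurs_at D L t k b) \<longleftrightarrow> t \<in> L ` {x \<in> D. fst x = k}"
    by (force simp: occurs_at_def)
  then show ?thesis
    using column_image[OF assms] by simp
qed

lemma occurs_at_label: "occurs_at D L t k b \<Longrightarrow> t \<in> {1..n} \<and> k \<le> \<alpha> t"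
  using ex_occurs_at_iff[OF occurs_at_column_pos] by blast

lemma occurs_at_left:
  assumes "occurs_at D L t k b" "1 \<le> j" "j \<le> k"
  obtains a where "occurs_at D L t j a"
  using assms occurs_at_label[OF assms(1)] ex_occurs_at_iff[of j t] by auto

lemma occurs_at_row_le: "occurs_at D L t k b \<Longrightarrow> b \<le> t"
  using semi_proper_of_shape by (auto simp: semi_proper_of_shape_def occurs_at_def)

lemma occurs_at_descend:
  assumes "occurs_at D L t j a" "occurs_at D L t k b" "j \<le> k"
  shows "b \<le> a"
proof (cases "j = k")
  case True
  then show ?thesis using assms occurs_at_unique by blast
next
  case False
  have "\<forall>x \<in> D. \<forall>y \<in> D. L x = L y \<and> fst x < fst y \<longrightarrow> snd y \<le> snd x"
    using semi_proper_of_shape by (simp add: semi_proper_of_shape_def)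
  then show ?thesis using False assms by (fastforce simp: occurs_at_def)
qed

lemma shape_part: "t \<in> {1..n} \<Longrightarrow> shape_part D L t = \<alpha> t"
  by (rule shape_part_eq[OF diagram semi_proper_of_shape])

section \<open>Relative position of the two label paths around an abutment\<close>

context
  fixes c r s :: nat
  assumes abuts: "abuts D L c r s"
begin

definition last_column :: nat where
  "last_column = exchange_end D L c r s"

definition exchanged :: labeling where
  "exchanged = (\<lambda>x. if fst x \<in> {c + 1..last_column} then transpose r s (L x) else L x)"

lemma less: "r < s"
  using abuts by (simp add: abuts_def touches_def)

lemma touch_rows:
  obtains a b where "occurs_at D L r c a" "occurs_at D L s (c + 1) b" "b \<le> a"
  using abuts unfolding abuts_def touches_def by blast

lemma larger_occurs_next: "s \<in> {1..n}" "c + 1 \<le> \<alpha> s"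
proof -
  obtain b where "occurs_at D L s (c + 1) b" by (rule touch_rows)
  from occurs_at_label[OF this] show "s \<in> {1..n}" "c + 1 \<le> \<alpha> s" by simp_all
qed

lemma smaller_occurs: "r \<in> {1..n}" "1 \<le> c" "c \<le> \<alpha> r"
proof -
  obtain a where a: "occurs_at D L r c a" by (rule touch_rows)
  from occurs_at_label[OF a] occurs_at_column_pos[OF a]
  show "r \<in> {1..n}" "1 \<le> c" "c \<le> \<alpha> r" by simp_all
qed

lemma last_column_cases:
  obtains (touch) "c < last_column" "touches D L last_column r s"
  | (shape) "last_column = \<alpha> s" "\<And>k. c < k \<Longrightarrow> \<not> touches D L k r s"
proof (cases "\<exists>d > c. touches D L d r s")
  case True
  then have "c < last_column \<and> touches D L last_column r s"
    unfolding last_column_def exchange_end_def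
    using LeastI_ex[of "\<lambda>d. c < d \<and> touches D L d r s"] by auto
  then show ?thesis using touch by blast
next
  case False
  then have "last_column = shape_part D L s"
    unfolding last_column_def exchange_end_def by (rule if_not_P)
  then have "last_column = \<alpha> s"
    using shape_part[OF larger_occurs_next(1)] by simp
  then show ?thesis using False shape by blast
qed

lemma no_touch_before_last_column:
  assumes "c < k" "k < last_column"
  shows "\<not> touches D L k r s"
proof
  assume touch: "touches D L k r s"
  then have "last_column = (LEAST d. c < d \<and> touches D L d r s)"
    using assms(1) by (auto simp: last_column_def exchange_end_def)
  then show False
    using Least_le[of "\<lambda>d. c < d \<and> touches D L d r s" k] assms touch by simp
qed

lemma last_column_le: "last_column \<le> \<alpha> s"
proof (cases rule: last_column_cases)
  case touch
  then obtain b where "occurs_at D L s (last_column + 1) b"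
    unfolding touches_def by blast
  from occurs_at_label[OF this] show ?thesis by simp
qed simp

text \<open>A touch ending the exchange would need an \<open>r\<close> in column
  \<open>last_column\<close>. Without one the exchange runs to the last cell of \<open>s\<close>,
  the only case in which the shape may change.\<close>

lemma last_column_eq:
  assumes "\<alpha> r < last_column"
  shows "last_column = \<alpha> s"
proof (cases rule: last_column_cases)
  case touch
  then obtain a where "occurs_at D L r last_column a"
    unfolding touches_def by blast
  from occurs_at_label[OF this] show ?thesis using assms by simp
qed

lemma le_last_column:
  assumes "occurs_at D L s k b" and "\<And>j. \<lbrakk>c < j; j < k\<rbrakk> \<Longrightarrow> \<not> touches D L j r s"
  shows "k \<le> last_column"
proof (cases rule: last_column_cases)
  case touch
  then show ?thesis using assms(2) not_le by blast
next
  case shape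
  then show ?thesis using occurs_at_label[OF assms(1)] by simp
qed

text \<open>In column \<open>c + 1\<close> this is the absence of a crossing. Further right, the
  absence of a touch at \<open>k - 1\<close> puts \<open>r\<close> in column \<open>k - 1\<close>
  below \<open>s\<close> in column \<open>k\<close>, and \<open>r\<close> only descends.\<close>

lemma smaller_below:
  assumes r: "occurs_at D L r k a" and s: "occurs_at D L s k b"
    and k: "c < k" "k \<le> last_column"
  shows "a < b"
proof (cases "k = c + 1")
  case True
  obtain a0 b0 where touch: "occurs_at D L r c a0" "occurs_at D L s (c + 1) b0" "b0 \<le> a0"
    by (rule touch_rows)
  have "b0 = b" using s touch(2) True occurs_at_unique by simp
  then have "\<not> b < a"
    using abuts touch r True less unfolding abuts_def crosses_def by auto
  moreover have "a \<noteq> b"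
    using r s less by (auto simp: occurs_at_def)
  ultimately show ?thesis by simp
next
  case False
  define j where "j = k - 1"
  have j: "c < j" "j + 1 = k" "1 \<le> j" using False k(1) by (auto simp: j_def)
  obtain a' where a': "occurs_at D L r j a'"
    by (rule occurs_at_left[OF r j(3)]) (use j in simp_all)
  have "occurs_at D L s (j + 1) b" using s j(2) by simp
  moreover have "\<not> touches D L j r s"
    by (rule no_touch_before_last_column) (use j k in simp_all)
  ultimately have "a' < b" using a' less unfolding touches_def by (meson not_le)
  moreover have "a \<le> a'" using occurs_at_descend[OF a' r] j by simp
  ultimately show ?thesis by simp
qed

text \<open>Needed where \<open>s\<close> leaves the path of \<open>r\<close> and returns to its
  own. The touch at \<open>last_column\<close> gives the inequality, and descent of both paths
  spreads it. If the exchange ends with \<open>s\<close> itself, no such \<open>k\<close>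
  exists.\<close>

lemma larger_after_exchange_below:
  assumes r: "occurs_at D L r j a" and s: "occurs_at D L s k b"
    and "j \<le> last_column" "last_column < k"
  shows "b \<le> a"
proof (cases rule: last_column_cases)
  case touch
  then obtain a' b' where t: "occurs_at D L r last_column a'"
      "occurs_at D L s (last_column + 1) b'" "b' \<le> a'"
    unfolding touches_def by blast
  have "b \<le> b'" using occurs_at_descend[OF t(2) s] assms(4) by simp
  moreover have "a' \<le> a" using occurs_at_descend[OF r t(1)] assms(3) by simp
  ultimately show ?thesis using t(3) by simp
next
  case shape
  then show ?thesis using occurs_at_label[OF s] assms(4) by simp
qed

text \<open>The counterpart at the start, where \<open>r\<close> enters the path of
  \<open>s\<close>: the touch at \<open>c\<close>, spread by descent.\<close>

lemma larger_in_exchange_below: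
  assumes r: "occurs_at D L r j a" and s: "occurs_at D L s k b" and "j \<le> c" "c < k"
  shows "b \<le> a"
proof -
  obtain a' b' where t: "occurs_at D L r c a'" "occurs_at D L s (c + 1) b'" "b' \<le> a'"
    by (rule touch_rows)
  have "b \<le> b'" using occurs_at_descend[OF t(2) s] assms(4) by simp
  moreover have "a' \<le> a" using occurs_at_descend[OF r t(1)] assms(3) by simp
  ultimately show ?thesis using t(3) by simp
qed

section \<open>The exchanged labeling is semi-proper\<close>

lemma exchanged_occurs_at_iff:
  "occurs_at D exchanged t k b \<longleftrightarrow>
     occurs_at D L (if c < k \<and> k \<le> last_column then transpose r s t else t) k b"
  by (auto simp: occurs_at_def exchanged_def transpose_def)

text \<open>Only \<open>r\<close> is at risk: its new cells lie weakly below its cell in column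
  \<open>c\<close>, hence in rows at most \<open>r\<close>. The new cells of \<open>s\<close> were
  cells of \<open>r\<close>, in rows at most \<open>r < s\<close>.\<close>

lemma exchanged_row_le:
  assumes "occurs_at D exchanged t k b"
  shows "b \<le> t"
proof (cases "c < k \<and> k \<le> last_column")
  case True
  then have o: "occurs_at D L (transpose r s t) k b"
    using assms by (simp add: exchanged_occurs_at_iff)
  consider "t = r" | "t = s" | "t \<noteq> r" "t \<noteq> s" by blast
  then show ?thesis
  proof cases
    case 1
    obtain a' where t: "occurs_at D L r c a'" by (rule touch_rows)
    have "b \<le> a'"
      using larger_in_exchange_below[OF t, of k b] o True 1 by simp
    then show ?thesis using occurs_at_row_le[OF t] 1 by simp
  next
    case 2
    then have "b \<le> r" using occurs_at_row_le[OF o] by simp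
    then show ?thesis using less 2 by simp
  next
    case 3
    then show ?thesis using occurs_at_row_le[OF o] by simp
  qed
next
  case False
  show ?thesis
    using assms unfolding exchanged_occurs_at_iff if_not_P[OF False] by (rule occurs_at_row_le)
qed

lemma exchanged_descend:
  assumes a: "occurs_at D exchanged t j a" and b: "occurs_at D exchanged t k b" and jk: "j < k"
  shows "b \<le> a"
proof -
  let ?in = "\<lambda>i. c < i \<and> i \<le> last_column"
  have a': "occurs_at D L (if ?in j then transpose r s t else t) j a"
    and b': "occurs_at D L (if ?in k then transpose r s t else t) k b"
    using a b by (simp_all only: exchanged_occurs_at_iff)
  have j: "1 \<le> j" using occurs_at_column_pos a' by blast
  \<comment> \<open>The exchanged columns form an interval, so a pair with one column before it and
    the other after it also falls under \<open>same\<close>.\<close>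
  consider (same) "?in j \<longleftrightarrow> ?in k" | (enter) "j \<le> c" "?in k" | (leave) "?in j" "last_column < k"
    using jk by linarith
  then show ?thesis
  proof cases
    case same
    then show ?thesis using occurs_at_descend[of _ j a k b] a' b' jk by auto
  next
    case enter
    consider "t = r" | "t = s" | "t \<noteq> r" "t \<noteq> s" by blast
    then show ?thesis
    proof cases
      case 1
      then show ?thesis
        using a' b' enter larger_in_exchange_below[of j a k b] by simp
    next
      case 2
      then have o: "occurs_at D L s j a" "occurs_at D L r k b" using a' b' enter by simp_all
      \<comment> \<open>The old cell of \<open>s\<close> in column \<open>k\<close> serves as an
        intermediate point: above the \<open>r\<close> there, and weakly below the \<open>s\<close>
        in column \<open>j\<close>.\<close>
      have "k \<le> \<alpha> s" using enter last_column_le by simp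
      then obtain b1 where b1: "occurs_at D L s k b1"
        using ex_occurs_at_iff[of k s] larger_occurs_next j jk by auto
      have "b < b1" using smaller_below[OF o(2) b1] enter by simp
      also have "b1 \<le> a" using occurs_at_descend[OF o(1) b1] jk by simp
      finally show ?thesis by simp
    next
      case 3
      then show ?thesis using a' b' enter jk occurs_at_descend[of t j a k b] by simp
    qed
  next
    case leave
    consider "t = r" | "t = s" | "t \<noteq> r" "t \<noteq> s" by blast
    then show ?thesis
    proof cases
      case 1
      then have o: "occurs_at D L s j a" "occurs_at D L r k b" using a' b' leave by simp_all
      obtain a1 where a1: "occurs_at D L r j a1"
        using occurs_at_left[OF o(2) j] jk by auto
      have "b \<le> a1" using occurs_at_descend[OF a1 o(2)] jk by simp
      also have "a1 < a" using smaller_below[OF a1 o(1)] leave by simp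
      finally show ?thesis by simp
    next
      case 2
      then show ?thesis
        using a' b' leave larger_after_exchange_below[of j a k b] by simp
    next
      case 3
      then show ?thesis using a' b' leave jk occurs_at_descend[of t j a k b] by simp
    qed
  qed
qed

lemma exchanged_column_inj:
  assumes "1 \<le> k"
  shows "inj_on exchanged {x \<in> D. fst x = k}"
  using column_inj[OF assms]
  by (auto simp: inj_on_def exchanged_def transpose_eq_iff)

text \<open>If \<open>r\<close> ends before \<open>last_column\<close>, that column is also the end
  of \<open>s\<close>, so the two labels swap their lengths. Otherwise both occur in every exchanged
  column and the shape stays the same.\<close>

lemma exchanged_column_image:
  assumes "1 \<le> k"
  shows "exchanged ` {x \<in> D. fst x = k} =
    {t \<in> {1..n}. k \<le> (if \<alpha> r < last_column then \<alpha> \<circ> transpose r s else \<alpha>) t}"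
    (is "_ = {t \<in> _. k \<le> ?\<beta> t}")
proof -
  let ?u = "\<lambda>t. if c < k \<and> k \<le> last_column then transpose r s t else t"
  have shape: "?u t \<in> {1..n} \<and> k \<le> \<alpha> (?u t) \<longleftrightarrow> t \<in> {1..n} \<and> k \<le> ?\<beta> t" for t
    using smaller_occurs larger_occurs_next last_column_le last_column_eq
    by (auto simp: transpose_def)
  have "t \<in> exchanged ` {x \<in> D. fst x = k} \<longleftrightarrow> t \<in> {1..n} \<and> k \<le> ?\<beta> t" for t
  proof -
    have "t \<in> exchanged ` {x \<in> D. fst x = k} \<longleftrightarrow> (\<exists>b. occurs_at D exchanged t k b)"
      by (force simp: occurs_at_def)
    then show ?thesis
      by (simp only: exchanged_occurs_at_iff ex_occurs_at_iff[OF assms] shape)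
  qed
  then show ?thesis by blast
qed

lemma semi_proper_exchanged: "semi_proper n D exchanged"
proof -
  have "snd x \<le> exchanged x" if "x \<in> D" for x
    using exchanged_row_le[of "exchanged x" "fst x" "snd x"] that by (simp add: occurs_at_def)
  moreover have "snd y \<le> snd x"
    if "x \<in> D" "y \<in> D" "exchanged x = exchanged y" "fst x < fst y" for x y
    using exchanged_descend[of "exchanged x" "fst x" "snd x" "fst y" "snd y"] that
    by (simp add: occurs_at_def)
  ultimately show ?thesis
    unfolding semi_proper_def semi_proper_of_shape_def
    using exchanged_column_inj exchanged_column_image by blast
qed

lemma exchange_eq: "exchange n D c r s L = Some exchanged"
  using abuts semi_proper_of_shape
  by (auto simp: exchange_def semi_proper_def exchanged_def last_column_def)

end

end

text \<open>The only facts about a single exchange that the induction uses. The hypotheses on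
  \<open>e\<close> ensure that the exchange reaches column \<open>e\<close>; what happens beyond it
  is left open.\<close>

lemma exchange_semi_proper:
  assumes "diagram D" "semi_proper n D L" "abuts D L c r s" "occurs_at D L s e b"
    and "\<And>k. \<lbrakk>c < k; k < e\<rbrakk> \<Longrightarrow> \<not> touches D L k r s"
  obtains L' where "exchange n D c r s L = Some L'" "semi_proper n D L'"
    and "\<And>k t a. k \<le> c \<Longrightarrow> occurs_at D L' t k a \<longleftrightarrow> occurs_at D L t k a"
    and "\<And>k t a. \<lbrakk>c < k; k \<le> e\<rbrakk> \<Longrightarrow> occurs_at D L' t k a \<longleftrightarrow> occurs_at D L (transpose r s t) k a"
proof -
  obtain \<alpha> where "semi_proper_of_shape n \<alpha> D L"
    using assms(2) by (auto simp: semi_proper_def)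
  then interpret semi_proper_labeling n \<alpha> D L
    using assms(1) by unfold_locales
  have "e \<le> last_column c r s"
    using le_last_column[OF assms(3,4)] assms(5) by blast
  then show thesis
    using that[OF exchange_eq[OF assms(3)] semi_proper_exchanged[OF assms(3)]]
    by (auto simp: exchanged_occurs_at_iff[OF assms(3)])
qed

section \<open>Composites of exchanges\<close>

text \<open>The last condition omits the column \<open>k = c j\<close>, unlike \<^const>\<open>exchange_sequence\<close>: after an
  exchange ending at the last cell of \<open>r (Suc m)\<close>, the label \<open>r m\<close> may return to its old path and
  touch an earlier label there, so only this weaker condition is preserved.\<close>

definition weak_exchange_sequence ::
  "cell set \<Rightarrow> labeling \<Rightarrow> nat \<Rightarrow> (nat \<Rightarrow> nat) \<Rightarrow> (nat \<Rightarrow> nat) \<Rightarrow> bool" where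
  "weak_exchange_sequence D L m r c \<longleftrightarrow>
     (\<forall>i \<le> m. \<exists>b. occurs_at D L (r i) (c i) b) \<and>
     (\<forall>i < m. c i < c (Suc i)) \<and>
     (\<forall>i < m. abuts D L (c i) (r i) (r (Suc i))) \<and>
     (\<forall>j \<le> m. \<forall>i < j. \<forall>k. c i < k \<and> k < c j \<longrightarrow> \<not> touches D L k (r i) (r j))"

lemma exchange_sequence_weak:
  assumes "exchange_sequence D L m r c"
  shows "weak_exchange_sequence D L m r c"
proof -
  have "abuts D L (c i) (r i) (r (Suc i))" if "i < m" for i
  proof -
    have "Suc i \<in> {1..m}" using that by simp
    then show ?thesis
      using assms unfolding exchange_sequence_def by (metis diff_Suc_1)
  qed
  then show ?thesis
    using assms by (auto simp: exchange_sequence_def weak_exchange_sequence_def)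
qed

section \<open>Passing to a shorter exchange sequence\<close>

lemma lift_less_upto:
  fixes f :: "nat \<Rightarrow> nat"
  assumes "\<forall>i < m. f i < f (Suc i)" "i < j" "j \<le> m"
  shows "f i < f j"
  using assms(2,3)
proof (induction j rule: less_induct)
  case (less j)
  then obtain j' where j': "j = Suc j'" by (cases j) auto
  have "f j' < f j" using assms(1) less.prems j' by simp
  moreover have "f i \<le> f j'"
    using less.IH[of j'] less.prems j' by (cases "i = j'") auto
  ultimately show ?case by simp
qed

lemma abuts_cong:
  assumes "\<And>t a. occurs_at D L' t k a \<longleftrightarrow> occurs_at D L t k a"
    and "\<And>t a. occurs_at D L' t (k + 1) a \<longleftrightarrow> occurs_at D L t (k + 1) a"
  shows "abuts D L' k r s \<longleftrightarrow> abuts D L k r s"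
  unfolding abuts_def touches_def crosses_def assms ..

lemma touches_cong:
  assumes "\<And>a. occurs_at D L' r k a \<longleftrightarrow> occurs_at D L r k a"
    and "\<And>a. occurs_at D L' s (k + 1) a \<longleftrightarrow> occurs_at D L s (k + 1) a"
  shows "touches D L' k r s \<longleftrightarrow> touches D L k r s"
  unfolding touches_def assms ..

text \<open>Up to column \<open>c m\<close> nothing changes. From there to \<open>c (Suc m)\<close>,
  \<open>r m\<close> follows the old path of \<open>r (Suc m)\<close>, which touches no earlier
  label there, so \<open>q\<close> may be any column in this range containing
  \<open>r m\<close>.\<close>

lemma weak_exchange_sequence_step:
  assumes seq: "weak_exchange_sequence D L (Suc m) r c"
    and left: "\<And>k t a. k \<le> c m \<Longrightarrow> occurs_at D L' t k a \<longleftrightarrow> occurs_at D L t k a"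
    and right: "\<And>k t a. \<lbrakk>c m < k; k \<le> c (Suc m)\<rbrakk> \<Longrightarrow>
      occurs_at D L' t k a \<longleftrightarrow> occurs_at D L (transpose (r m) (r (Suc m)) t) k a"
    and q: "c m \<le> q" "q \<le> c (Suc m)" and occ: "\<exists>b. occurs_at D L' (r m) q b"
  shows "weak_exchange_sequence D L' m r (c(m := q))"
proof -
  have occurs: "\<And>i. i \<le> Suc m \<Longrightarrow> \<exists>b. occurs_at D L (r i) (c i) b"
    and c_step: "\<forall>i < Suc m. c i < c (Suc i)"
    and abut: "\<And>i. i < Suc m \<Longrightarrow> abuts D L (c i) (r i) (r (Suc i))"
    and notouch: "\<And>i j k. \<lbrakk>j \<le> Suc m; i < j; c i < k; k < c j\<rbrakk> \<Longrightarrow> \<not> touches D L k (r i) (r j)"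
    using seq unfolding weak_exchange_sequence_def by blast+
  have r_step: "\<forall>i < Suc m. r i < r (Suc i)"
    using abut by (auto simp: abuts_def touches_def)
  note c_less = lift_less_upto[OF c_step] and r_less = lift_less_upto[OF r_step]
  let ?c = "c(m := q)"
  have "\<exists>b. occurs_at D L' (r i) (?c i) b" if "i \<le> m" for i
  proof (cases "i = m")
    case False
    then have "c i < c m" using c_less[of i m] that by simp
    then show ?thesis using occurs[of i] left that False by simp
  qed (use occ in simp)
  moreover have "?c i < ?c (Suc i)" if "i < m" for i
    using c_step[rule_format, of i] q that by (auto intro: less_le_trans)
  moreover have "abuts D L' (?c i) (r i) (r (Suc i))" if "i < m" for i
  proof -
    \<comment> \<open>Both columns of the abutment, \<open>c i\<close> and \<open>c i + 1\<close>,
      lie in the unchanged region.\<close>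
    have "c i < c m" using c_less[of i m] that by simp
    then have "abuts D L' (c i) (r i) (r (Suc i)) \<longleftrightarrow> abuts D L (c i) (r i) (r (Suc i))"
      using left by (intro abuts_cong) simp_all
    then show ?thesis using abut that by simp
  qed
  moreover have "\<not> touches D L' k (r i) (r j)"
    if "j \<le> m" "i < j" "?c i < k" "k < ?c j" for i j k
  proof (cases "k < c m")
    case True
    then have "k < c j" using that by (cases "j = m") auto
    moreover have "touches D L' k (r i) (r j) \<longleftrightarrow> touches D L k (r i) (r j)"
      using left True by (intro touches_cong) simp_all
    ultimately show ?thesis using notouch[of j i k] that by simp
  next
    case False
    have j: "j = m"
    proof (rule ccontr)
      assume "j \<noteq> m"
      then show False using c_less[of j m] that False by simp
    qed
    \<comment> \<open>The strict bound \<open>k < q\<close> keeps column \<open>k + 1\<close> within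
      the range described by \<open>right\<close>.\<close>
    have k: "c m \<le> k" "k + 1 \<le> c (Suc m)" "c i < k" "i < m"
      using that j False q by auto
    have neq: "r i \<noteq> r m" "r i \<noteq> r (Suc m)" and "r i < r (Suc m)"
      using r_less[of i m] r_less[of i "Suc m"] k by auto
    have row_i: "occurs_at D L' (r i) k a \<longleftrightarrow> occurs_at D L (r i) k a" for a
      using left[of k] right[of k] k neq by (cases "k = c m") auto
    have row_m: "occurs_at D L' (r m) (k + 1) a \<longleftrightarrow> occurs_at D L (r (Suc m)) (k + 1) a" for a
      using right[of "k + 1"] k by simp
    have "\<not> touches D L k (r i) (r (Suc m))"
      using notouch[of "Suc m" i k] k by simp
    then show ?thesis
      using \<open>r i < r (Suc m)\<close> unfolding touches_def j row_i row_m by blast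
  qed
  ultimately show ?thesis by (simp add: weak_exchange_sequence_def)
qed

text \<open>The composite never reads \<open>c m\<close>, so replacing \<open>c m\<close> by
  \<open>q\<close> leaves it the same.\<close>

lemma exchange_composite_cong:
  "(\<And>i. i < m \<Longrightarrow> c i = c' i) \<Longrightarrow> exchange_composite n D r c m L = exchange_composite n D r c' m L"
proof (induction m arbitrary: L)
  case (Suc m)
  then have "exchange_composite n D r c m = exchange_composite n D r c' m" by auto
  then show ?case using Suc.prems[of m] by simp
qed simp

lemma weak_exchange_sequence_composite:
  assumes "diagram D" "semi_proper n D L" "weak_exchange_sequence D L m r c"
  shows "\<exists>L'. exchange_composite n D r c m L = Some L' \<and> semi_proper n D L' \<and>
    (\<forall>i \<le> m. \<forall>b. occurs_at D L (r i) (c i) b \<longrightarrow> L' (c i, b) = r 0)"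
  using assms(2,3)
\<comment> \<open>\<open>c\<close> is generalized because the hypothesis is applied to sequences
  with an altered last column.\<close>
proof (induction m arbitrary: L c)
  case 0
  then show ?case by (auto simp: occurs_at_def)
next
  case (Suc m)
  have seq: "\<And>i. i \<le> Suc m \<Longrightarrow> \<exists>b. occurs_at D L (r i) (c i) b"
    and c_step: "\<forall>i < Suc m. c i < c (Suc i)"
    and abut: "abuts D L (c m) (r m) (r (Suc m))"
    and notouch: "\<And>k. \<lbrakk>c m < k; k < c (Suc m)\<rbrakk> \<Longrightarrow> \<not> touches D L k (r m) (r (Suc m))"
    using Suc.prems(2) unfolding weak_exchange_sequence_def by blast+
  have c_le: "c i \<le> c m" if "i \<le> m" for i
    using lift_less_upto[OF c_step, of i m] that by (cases "i = m") auto
  obtain b where b: "occurs_at D L (r (Suc m)) (c (Suc m)) b" using seq[of "Suc m"] by auto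
  obtain L1 where ex: "exchange n D (c m) (r m) (r (Suc m)) L = Some L1"
    and sp: "semi_proper n D L1"
    and left: "\<And>k t a. k \<le> c m \<Longrightarrow> occurs_at D L1 t k a \<longleftrightarrow> occurs_at D L t k a"
    and right: "\<And>k t a. \<lbrakk>c m < k; k \<le> c (Suc m)\<rbrakk> \<Longrightarrow>
      occurs_at D L1 t k a \<longleftrightarrow> occurs_at D L (transpose (r m) (r (Suc m)) t) k a"
    by (rule exchange_semi_proper[OF assms(1) Suc.prems(1) abut b notouch]) blast+
  have last: "occurs_at D L1 (r m) (c (Suc m)) a \<longleftrightarrow> occurs_at D L (r (Suc m)) (c (Suc m)) a" for a
    using right[of "c (Suc m)"] c_step by simp
  have IH: "\<exists>L'. exchange_composite n D r c m L1 = Some L' \<and> semi_proper n D L' \<and>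
      (\<forall>i \<le> m. \<forall>b. occurs_at D L1 (r i) ((c(m := q)) i) b \<longrightarrow> L' ((c(m := q)) i, b) = r 0)"
    if "c m \<le> q" "q \<le> c (Suc m)" "\<exists>b. occurs_at D L1 (r m) q b" for q
  proof -
    have "exchange_composite n D r c m L1 = exchange_composite n D r (c(m := q)) m L1"
      by (rule exchange_composite_cong) simp
    then show ?thesis
      using Suc.IH[OF sp weak_exchange_sequence_step[OF Suc.prems(2) left right that]]
      by (simp only:)
  qed
  \<comment> \<open>The choice \<open>q = c m\<close> handles the cells of \<open>r 0\<close> to
    \<open>r m\<close>.\<close>
  obtain L' where L': "exchange_composite n D r c m L1 = Some L'" "semi_proper n D L'"
    and early: "\<And>i b. \<lbrakk>i \<le> m; occurs_at D L1 (r i) (c i) b\<rbrakk> \<Longrightarrow> L' (c i, b) = r 0"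
    using IH[of "c m"] c_step left seq[of m] by (auto simp: less_imp_le)
  \<comment> \<open>The choice \<open>q = c (Suc m)\<close> handles the cell of
    \<open>r (Suc m)\<close>, which carries \<open>r m\<close> after the first exchange. The
    composite is the same, so the resulting labeling is again \<open>L'\<close>.\<close>
  have late: "L' (c (Suc m), b) = r 0" if "occurs_at D L1 (r m) (c (Suc m)) b" for b
  proof -
    have "\<forall>i \<le> m. \<forall>b. occurs_at D L1 (r i) ((c(m := c (Suc m))) i) b \<longrightarrow>
        L' ((c(m := c (Suc m))) i, b) = r 0"
      using IH[of "c (Suc m)"] c_step L'(1) that by (auto simp: less_imp_le simp del: fun_upd_apply)
    from this[rule_format, of m b] show ?thesis using that by simp
  qed
  have "L' (c i, b) = r 0" if "i \<le> Suc m" "occurs_at D L (r i) (c i) b" for i b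
  proof (cases "i = Suc m")
    case True
    then show ?thesis using that late last by simp
  next
    case False
    then have "i \<le> m" using that by simp
    then show ?thesis using early[of i b] left[OF c_le] that(2) by simp
  qed
  then show ?case using ex L' by auto
qed

theorem theorem3p6:
  fixes n m :: nat and D :: "cell set" and L :: labeling and r c :: "nat \<Rightarrow> nat"
  assumes "diagram D"
    and "semi_proper n D L"
    and "exchange_sequence D L m r c"
  shows "\<exists>L'. exchange_composite n D r c m L = Some L' \<and>
              semi_proper n D L' \<and>
              (\<forall>i \<le> m. \<forall>b. occurs_at D L (r i) (c i) b \<longrightarrow> L' (c i, b) = r 0)"
  by (rule weak_exchange_sequence_composite[OF assms(1,2) exchange_sequence_weak[OF assms(3)]])

end
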